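(* Let $I$ be an umbral graph polynomial invariant with values in the polynomial ring $\mathbb{C}[q_1,q_2,\dots]$ in infinitely many variables, and let $$\mathcal{I}^\circ(q_1,q_2,\dots)=\sum_{G}\frac{I_G(q_1,q_2,\dots)}{|\mathrm{Aut}(G)|},$$ the sum running over all graphs (isomorphism classes of simple graphs, including the empty graph). After the rescaling of the variables $$q_n=\frac{2^{n(n-1)/2}(n-1)!}{i_n}\,p_n,\qquad n=1,2,\dots,$$ where the constants $i_n$ are given by $$i_n=n!\sum_{G\text{ connected}}\frac{[q_n]I_G(q_1,q_2,\dots)}{|\mathrm{Aut}(G)|}$$ (the sum running over isomorphism classes of non-empty connected simple graphs, $[q_n]I_G$ denoting the coefficient of the monomial $q_n$ in $I_G$), the generating function $\mathcal{I}^\circ$ becomes the following linear combination of one-part Schur polynomials: $$\mathcal{S}(p_1,p_2,\dots)=1+2^0s_1(p_1)+2^1s_2(p_1,p_2)+\dots+2^{n(n-1)/2}s_n(p_1,p_2,\dots,p_n)+\dots.$$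
   Context: Graphs are finite; a simple graph has no loops or multiple edges. $\mathrm{Aut}(G)$ is the automorphism group of $G$ and $|\mathrm{Aut}(G)|$ its order. The empty graph is not counted as connected. Hopf algebra of graphs. $\mathcal{G}=\bigoplus_{n\ge0}\mathcal{G}_n$ is the graded vector space over $\mathbb{C}$ with basis the isomorphism classes of simple graphs, $\mathcal{G}_n$ being spanned by graphs with $n$ vertices. The product is disjoint union (unit: the empty graph) and the coproduct is $\Delta(G)=\sum_{V(G)=V_1\sqcup V_2}G(V_1)\otimes G(V_2)$, the sum over ordered partitions of $V(G)$ into two (possibly empty) subsets, with $G(V_i)$ the induced subgraph; the counit is $1$ on the empty graph and $0$ on all other graphs. This is a commutative cocommutative graded Hopf algebra. The polynomial ring $\mathbb{C}[q_1,q_2,\dots]$ is a graded Hopf algebra with its usual multiplication, $\deg q_n=n$ and $\Delta(q_n)=q_n\otimes1+1\otimes q_n$. An umbral graph polynomial invariant is an arbitrary homomorphism of graded Hopf algebras $I:\mathcal{G}\to\mathbb{C}[q_1,q_2,\dots]$, $G\mapsto I_G$. The one-part Schur polynomials $s_n=s_n(p_1,\dots,p_n)$ are defined by $\sum_{n\ge0}s_n=\exp\left(\sum_{k\ge1}p_k/k\right)$, $s_n$ being the part of weighted degree $n$, where $p_i$ has degree $i$.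
   Formalization: The formal statement adds the assumption that every constant i_n (n ≥ 1) is non-zero; otherwise the rescaling divides by zero and is undefined, as for the trivial invariant with I_G = 0 for every non-empty graph. *)

theory Defs
  imports Complex_Main "HOL-Library.Poly_Mapping" "HOL-Library.Product_Plus"
    "HOL-Combinatorics.Permutations"
begin

section \<open>Simple graphs and their isomorphism classes\<close>

text \<open>A graph is a pair of a vertex set and a set of edges, an edge being a two-element set of
  vertices. The isomorphism relation is restricted to finite simple graphs, so that it is a partial
  equivalence relation. Every finite simple graph is isomorphic to one with vertices in
  \<^typ>\<open>nat\<close>.\<close>

type_synonym 'a pregraph = "'a set \<times> 'a set set"

abbreviation verts :: "'a pregraph \<Rightarrow> 'a set" where "verts \<equiv> fst"
abbreviation edges :: "'a pregraph \<Rightarrow> 'a set set" where "edges \<equiv> snd"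

definition simple_graph :: "'a pregraph \<Rightarrow> bool" where
  "simple_graph G \<longleftrightarrow> finite (verts G) \<and> (\<forall>e\<in>edges G. e \<subseteq> verts G \<and> card e = 2)"

definition graph_map :: "('a \<Rightarrow> 'b) \<Rightarrow> 'a pregraph \<Rightarrow> 'b pregraph \<Rightarrow> bool" where
  "graph_map f G H \<longleftrightarrow> bij_betw f (verts G) (verts H) \<and> (`) f ` edges G = edges H"

definition graph_iso :: "'a pregraph \<Rightarrow> 'b pregraph \<Rightarrow> bool" where
  "graph_iso G H \<longleftrightarrow> simple_graph G \<and> simple_graph H \<and> (\<exists>f. graph_map f G H)"

definition automorphisms :: "'a pregraph \<Rightarrow> ('a \<Rightarrow> 'a) set" where
  "automorphisms G = {f. f permutes verts G \<and> (`) f ` edges G = edges G}"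

definition connected_graph :: "'a pregraph \<Rightarrow> bool" where
  "connected_graph G \<longleftrightarrow> verts G \<noteq> {} \<and>
     (\<forall>u\<in>verts G. \<forall>v\<in>verts G. (u, v) \<in> {(x, y). {x, y} \<in> edges G}\<^sup>*)"

definition induced :: "'a pregraph \<Rightarrow> 'a set \<Rightarrow> 'a pregraph" where
  "induced G W = (W, {e \<in> edges G. e \<subseteq> W})"

text \<open>The vertices of the first graph are moved to the even and those of the second graph to the
  odd numbers.\<close>

definition disjoint_union :: "nat pregraph \<Rightarrow> nat pregraph \<Rightarrow> nat pregraph" where
  "disjoint_union G H =
     ((\<lambda>v. 2 * v) ` verts G \<union> (\<lambda>v. 2 * v + 1) ` verts H,
      (`) (\<lambda>v. 2 * v) ` edges G \<union> (`) (\<lambda>v. 2 * v + 1) ` edges H)"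

lemma graph_map_id: "graph_map id G G"
  by (simp add: graph_map_def image_image)

lemma graph_map_comp:
  assumes "graph_map f G H" "graph_map g H K"
  shows "graph_map (g \<circ> f) G K"
proof -
  have "(`) (g \<circ> f) ` edges G = (`) g ` (`) f ` edges G"
    by (simp add: image_image image_comp[symmetric])
  then show ?thesis
    using assms by (auto simp: graph_map_def intro: bij_betw_trans)
qed

lemma graph_map_inv:
  assumes "simple_graph G" "graph_map f G H"
  shows "graph_map (inv_into (verts G) f) H G"
proof -
  have b: "bij_betw f (verts G) (verts H)" and e: "(`) f ` edges G = edges H"
    using assms(2) by (auto simp: graph_map_def)
  have i: "inj_on f (verts G)" using b by (rule bij_betw_imp_inj_on)
  have "inv_into (verts G) f ` f ` s = s" if "s \<in> edges G" for s
    using that assms(1) i by (simp add: simple_graph_def inv_into_image_cancel)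
  then have "(`) (inv_into (verts G) f) ` edges H = edges G"
    unfolding e[symmetric] by (simp add: image_image)
  then show ?thesis
    using b by (simp add: graph_map_def bij_betw_inv_into)
qed

lemma graph_iso_sym: "graph_iso G H \<Longrightarrow> graph_iso H G"
  unfolding graph_iso_def using graph_map_inv by blast

lemma graph_iso_trans: "graph_iso G H \<Longrightarrow> graph_iso H K \<Longrightarrow> graph_iso G K"
  unfolding graph_iso_def using graph_map_comp by blast

lemma graph_iso_refl: "simple_graph G \<Longrightarrow> graph_iso G G"
  unfolding graph_iso_def using graph_map_id by blast

lemma simple_graph_empty: "simple_graph ({}, {})"
  by (simp add: simple_graph_def)

lemma simple_graph_induced: "simple_graph G \<Longrightarrow> W \<subseteq> verts G \<Longrightarrow> simple_graph (induced G W)"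
  by (auto simp: simple_graph_def induced_def intro: finite_subset)

lemma simple_graph_map:
  assumes "simple_graph G" "inj_on f (verts G)"
  shows "simple_graph (f ` verts G, (`) f ` edges G)"
  using assms by (auto simp: simple_graph_def card_image inj_on_subset)

lemma simple_graph_Un:
  "simple_graph (V, E) \<Longrightarrow> simple_graph (W, F) \<Longrightarrow> simple_graph (V \<union> W, E \<union> F)"
  by (auto simp: simple_graph_def)

lemma simple_graph_disjoint_union:
  assumes "simple_graph G" "simple_graph H"
  shows "simple_graph (disjoint_union G H)"
proof -
  have "simple_graph ((\<lambda>v. 2 * v) ` verts G, (`) (\<lambda>v. 2 * v) ` edges G)"
    using assms by (intro simple_graph_map) (auto simp: inj_on_def)
  moreover have "simple_graph ((\<lambda>v. 2 * v + 1) ` verts H, (`) (\<lambda>v. 2 * v + 1) ` edges H)"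
    using assms by (intro simple_graph_map) (auto simp: inj_on_def)
  ultimately show ?thesis
    unfolding disjoint_union_def by (rule simple_graph_Un)
qed

lemma graph_iso_induced:
  assumes "simple_graph G" "simple_graph H" "graph_map f G H" "W \<subseteq> verts G"
  shows "graph_iso (induced G W) (induced H (f ` W))"
proof -
  have b: "bij_betw f (verts G) (verts H)" and e: "(`) f ` edges G = edges H"
    using assms(3) by (auto simp: graph_map_def)
  have i: "inj_on f (verts G)" using b by (rule bij_betw_imp_inj_on)
  have "f ` W \<subseteq> verts H"
    using b assms(4) by (auto simp: bij_betw_def)
  moreover have "(f ` s \<subseteq> f ` W) = (s \<subseteq> W)" if "s \<in> edges G" for s
    using that assms(1,4) i unfolding simple_graph_def inj_on_def by blast
  then have "(`) f ` {s \<in> edges G. s \<subseteq> W} = {s \<in> edges H. s \<subseteq> f ` W}"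
    unfolding e[symmetric] by auto
  moreover have "bij_betw f W (f ` W)"
    using i assms(4) by (auto simp: bij_betw_def intro: inj_on_subset)
  ultimately show ?thesis
    using assms unfolding graph_iso_def graph_map_def
    by (intro conjI simple_graph_induced) (auto simp: induced_def)
qed

lemma bij_betw_induced:
  assumes "bij_betw f A B"
  shows "bij_betw ((`) f) (Pow A) (Pow B)" "\<And>W. W \<subseteq> A \<Longrightarrow> B - f ` W = f ` (A - W)"
  using bij_betw_Pow[OF assms] assms by (auto simp: bij_betw_def inj_on_image_set_diff[of f A])

lemma graph_iso_disjoint_union:
  assumes "graph_iso G G'" "graph_iso H H'"
  shows "graph_iso (disjoint_union G H) (disjoint_union G' H')"
proof -
  obtain f g where f: "graph_map f G G'" and g: "graph_map g H H'"
    using assms by (auto simp: graph_iso_def)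
  define h where "h v = (if even v then 2 * f (v div 2) else 2 * g (v div 2) + 1)" for v :: nat
  have h0: "h (2 * v) = 2 * f v" and h1: "h (Suc (2 * v)) = Suc (2 * g v)" for v
    by (auto simp: h_def)
  have fi: "inj_on f (verts G)" and gi: "inj_on g (verts H)"
    using f g by (auto simp: graph_map_def bij_betw_def)
  have "inj_on h ((\<lambda>v. 2 * v) ` verts G)" "inj_on h ((\<lambda>v. 2 * v + 1) ` verts H)"
    by (auto intro!: inj_onI simp: h0 h1 dest: inj_onD[OF fi] inj_onD[OF gi])
  moreover have "h ` (\<lambda>v. 2 * v) ` verts G \<inter> h ` (\<lambda>v. 2 * v + 1) ` verts H = {}"
    by (auto simp: h0 h1 Suc_double_not_eq_double double_not_eq_Suc_double)
  ultimately have "inj_on h (verts (disjoint_union G H))"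
    unfolding disjoint_union_def fst_conv inj_on_Un by blast
  moreover have "h ` verts (disjoint_union G H) = verts (disjoint_union G' H')"
  proof -
    have "verts G' = f ` verts G" "verts H' = g ` verts H"
      using f g by (auto simp: graph_map_def bij_betw_def)
    then show ?thesis
      by (simp add: disjoint_union_def image_Un image_image h0 h1)
  qed
  moreover have "(`) h ` edges (disjoint_union G H) = edges (disjoint_union G' H')"
  proof -
    have "edges G' = (`) f ` edges G" "edges H' = (`) g ` edges H"
      using f g by (auto simp: graph_map_def)
    then show ?thesis
      by (simp add: disjoint_union_def image_Un image_image h0 h1)
  qed
  ultimately have "graph_map h (disjoint_union G H) (disjoint_union G' H')"
    by (simp add: graph_map_def bij_betw_def)
  then show ?thesis
    using assms by (auto simp: graph_iso_def simple_graph_disjoint_union)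
qed

lemma graph_iso_imp_connected:
  assumes "graph_iso G H" "connected_graph G"
  shows "connected_graph H"
proof -
  obtain f where f: "bij_betw f (verts G) (verts H)" "(`) f ` edges G = edges H"
    using assms(1) by (auto simp: graph_iso_def graph_map_def)
  have step: "(f u, f v) \<in> {(x, y). {x, y} \<in> edges H}\<^sup>*"
    if "(u, v) \<in> {(x, y). {x, y} \<in> edges G}\<^sup>*" for u v
    using that
  proof induction
    case (step y z)
    then have "f ` {y, z} \<in> (`) f ` edges G" by blast
    then have "{f y, f z} \<in> edges H" using f(2) by simp
    then show ?case using step.IH by (auto intro: rtrancl_into_rtrancl)
  qed simp
  have "verts H = f ` verts G" using f(1) by (simp add: bij_betw_def)
  then show ?thesis
    using assms(2) step unfolding connected_graph_def by auto
qed

lemma card_automorphisms_le: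
  assumes "graph_iso G H"
  shows "card (automorphisms G) \<le> card (automorphisms H)"
proof -
  obtain f where f: "graph_map f G H" using assms by (auto simp: graph_iso_def)
  have sG: "simple_graph G" and sH: "simple_graph H" using assms by (auto simp: graph_iso_def)
  have b: "bij_betw f (verts G) (verts H)" using f by (simp add: graph_map_def)
  define g where "g = inv_into (verts G) f"
  define F where "F = (\<lambda>\<pi> x. if x \<in> verts H then f (\<pi> (g x)) else x)"
  have bF: "bij_betw F {\<pi>. \<pi> permutes verts G} {\<pi>. \<pi> permutes verts H}"
    using bij_betw_permutations[OF b] unfolding F_def g_def .
  have sub: "automorphisms G \<subseteq> {\<pi>. \<pi> permutes verts G}"
    by (auto simp: automorphisms_def)
  have "F \<pi> \<in> automorphisms H" if p: "\<pi> \<in> automorphisms G" for \<pi>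
  proof -
    have 1: "F \<pi> permutes verts H" using bF p sub by (auto simp: bij_betw_def)
    have "graph_map \<pi> G G"
      using p by (auto simp: automorphisms_def graph_map_def permutes_imp_bij)
    then have m: "graph_map (f \<circ> (\<pi> \<circ> g)) H H"
      using graph_map_comp[OF graph_map_comp[OF graph_map_inv[OF sG f]] f]
      by (simp add: g_def)
    have "F \<pi> ` s = (f \<circ> (\<pi> \<circ> g)) ` s" if "s \<in> edges H" for s
      using that sH by (intro image_cong) (auto simp: simple_graph_def F_def)
    then have "(`) (F \<pi>) ` edges H = (`) (f \<circ> (\<pi> \<circ> g)) ` edges H"
      by (rule image_cong[OF refl])
    then show ?thesis using 1 m by (simp add: automorphisms_def graph_map_def)
  qed
  moreover have "inj_on F (automorphisms G)"
    using bF sub by (auto simp: bij_betw_def intro: inj_on_subset)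
  moreover have "finite (automorphisms H)"
    using sH by (auto simp: automorphisms_def simple_graph_def
        intro: finite_subset[OF _ finite_permutations])
  ultimately show ?thesis by (intro card_inj_on_le[of F]) auto
qed

quotient_type graph_class = "nat pregraph" / partial: graph_iso
proof (rule part_equivpI)
  show "\<exists>G :: nat pregraph. graph_iso G G"
    using graph_iso_refl[OF simple_graph_empty] by blast
  show "symp (graph_iso :: nat pregraph \<Rightarrow> _)"
    by (auto intro: sympI graph_iso_sym)
  show "transp (graph_iso :: nat pregraph \<Rightarrow> _)"
    by (auto intro: transpI graph_iso_trans)
qed

lift_definition num_verts :: "graph_class \<Rightarrow> nat" is "\<lambda>G. card (verts G)"
  by (auto simp: graph_iso_def graph_map_def bij_betw_same_card)

lift_definition aut_order :: "graph_class \<Rightarrow> nat" is "\<lambda>G. card (automorphisms G)"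
  by (rule antisym) (simp_all add: card_automorphisms_le graph_iso_sym)

lift_definition is_connected :: "graph_class \<Rightarrow> bool" is connected_graph
  by (metis graph_iso_imp_connected graph_iso_sym)

instantiation graph_class :: comm_monoid_add
begin

lift_definition zero_graph_class :: graph_class is "({}, {})"
  by (rule graph_iso_refl[OF simple_graph_empty])

lift_definition plus_graph_class :: "graph_class \<Rightarrow> graph_class \<Rightarrow> graph_class" is disjoint_union
  by (rule graph_iso_disjoint_union)

instance
proof
  fix a b c :: graph_class
  show "a + b + c = a + (b + c)"
  proof (transfer, goal_cases)
    case (1 A B C)
    define h :: "nat \<Rightarrow> nat" where
      "h v = (if v mod 4 = 0 then v div 2 else if v mod 4 = 2 then v - 1 else 2 * v + 1)" for v
    have h: "h (2 * (2 * v)) = 2 * v" "h (2 * Suc (2 * v)) = Suc (2 * (2 * v))"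
      "h (Suc (2 * v)) = Suc (2 * Suc (2 * v))" for v
      by (simp_all add: h_def mod_Suc, presburger+)
    have i: "inj h"
    proof (rule inj_on_inverseI)
      fix v
      define g :: "nat \<Rightarrow> nat" where
        "g w = (if even w then 2 * w else if w mod 4 = 1 then w + 1 else w div 2)" for w
      consider k where "v = 2 * (2 * k)" | k where "v = 2 * Suc (2 * k)" | k where "v = Suc (2 * k)"
        by (metis evenE oddE Suc_eq_plus1)
      then show "g (h v) = v"
        by cases (simp_all only: h, simp_all add: g_def mod_Suc)
    qed
    have "graph_map h (disjoint_union (disjoint_union A B) C)
            (disjoint_union A (disjoint_union B C))"
      unfolding graph_map_def bij_betw_def
      using inj_on_subset[OF i subset_UNIV]
      by (simp add: disjoint_union_def image_Un image_image h[simplified] Un_assoc)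
    then show ?case
      using 1 by (auto simp: graph_iso_def simple_graph_disjoint_union)
  qed
  show "a + b = b + a"
  proof (transfer, goal_cases)
    case (1 A B)
    define h :: "nat \<Rightarrow> nat" where "h v = (if even v then v + 1 else v - 1)" for v
    have h: "h (2 * v) = Suc (2 * v)" "h (Suc (2 * v)) = 2 * v" for v
      unfolding h_def by simp_all
    have i: "inj h"
      by (rule inj_on_inverseI[of _ h]) (auto simp: h_def)
    have "graph_map h (disjoint_union A B) (disjoint_union B A)"
      unfolding graph_map_def bij_betw_def
      using inj_on_subset[OF i subset_UNIV]
      by (simp add: disjoint_union_def image_Un image_image h Un_commute)
    then show ?case
      using 1 by (auto simp: graph_iso_def simple_graph_disjoint_union)
  qed
  show "0 + a = a"
  proof (transfer, goal_cases)
    case (1 A)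
    define h :: "nat \<Rightarrow> nat" where "h v = v div 2" for v
    have h: "h (Suc (2 * v)) = v" for v unfolding h_def by simp
    have "graph_map h (disjoint_union ({}, {}) A) A"
      unfolding graph_map_def bij_betw_def
      by (auto simp: disjoint_union_def image_image h inj_on_def)
    then show ?case
      using 1 simple_graph_disjoint_union[OF simple_graph_empty]
      by (auto simp: graph_iso_def)
  qed
qed

end


section \<open>Linear algebra on free vector spaces\<close>

text \<open>The type \<^typ>\<open>'a \<Rightarrow>\<^sub>0 complex\<close> is the complex vector space with basis \<^typ>\<open>'a\<close>. If
  \<^typ>\<open>'a\<close> is a commutative monoid, the library makes this space the monoid algebra, and
  \<^typ>\<open>'a \<times> 'a \<Rightarrow>\<^sub>0 complex\<close> is then the tensor square of that algebra.\<close>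

abbreviation basis :: "'a \<Rightarrow> 'a \<Rightarrow>\<^sub>0 complex" where
  "basis a \<equiv> Poly_Mapping.single a 1"

definition scale :: "complex \<Rightarrow> ('a \<Rightarrow>\<^sub>0 complex) \<Rightarrow> 'a \<Rightarrow>\<^sub>0 complex" where
  "scale c x = Poly_Mapping.map ((*) c) x"

lemma lookup_scale: "Poly_Mapping.lookup (scale c x) a = c * Poly_Mapping.lookup x a"
  by (simp add: scale_def map.rep_eq when_def)

lemma vector_space_scale: "vector_space scale"
  by unfold_locales (auto intro!: poly_mapping_eqI simp: lookup_scale lookup_add algebra_simps)

definition lin_ext :: "('a \<Rightarrow> 'b \<Rightarrow>\<^sub>0 complex) \<Rightarrow> ('a \<Rightarrow>\<^sub>0 complex) \<Rightarrow> 'b \<Rightarrow>\<^sub>0 complex" where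
  "lin_ext f x = (\<Sum>a\<in>Poly_Mapping.keys x. scale (Poly_Mapping.lookup x a) (f a))"

definition tensor :: "('a \<Rightarrow>\<^sub>0 complex) \<Rightarrow> ('b \<Rightarrow>\<^sub>0 complex) \<Rightarrow> 'a \<times> 'b \<Rightarrow>\<^sub>0 complex" where
  "tensor x y = (\<Sum>a\<in>Poly_Mapping.keys x. \<Sum>b\<in>Poly_Mapping.keys y.
     Poly_Mapping.single (a, b) (Poly_Mapping.lookup x a * Poly_Mapping.lookup y b))"

definition tensor_map ::
  "(('a \<Rightarrow>\<^sub>0 complex) \<Rightarrow> 'b \<Rightarrow>\<^sub>0 complex) \<Rightarrow> ('a \<times> 'a \<Rightarrow>\<^sub>0 complex) \<Rightarrow> 'b \<times> 'b \<Rightarrow>\<^sub>0 complex" where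
  "tensor_map f = lin_ext (\<lambda>(a, b). tensor (f (basis a)) (f (basis b)))"

definition counit :: "('a::zero \<Rightarrow>\<^sub>0 complex) \<Rightarrow> complex" where
  "counit x = Poly_Mapping.lookup x 0"

definition homogeneous :: "('a \<Rightarrow> nat) \<Rightarrow> nat \<Rightarrow> ('a \<Rightarrow>\<^sub>0 complex) set" where
  "homogeneous d n = {x. \<forall>a\<in>Poly_Mapping.keys x. d a = n}"


section \<open>The two Hopf algebras\<close>

text \<open>The product of \<^term>\<open>basis G\<close> and \<^term>\<open>basis H\<close> in \<open>graph_algebra\<close> is the basis
  element of the disjoint union, and the unit is the basis element of the empty graph.\<close>

type_synonym graph_algebra = "graph_class \<Rightarrow>\<^sub>0 complex"

lift_definition graph_coproduct_basis :: "graph_class \<Rightarrow> graph_class \<times> graph_class \<Rightarrow>\<^sub>0 complex" is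
  "\<lambda>G. \<Sum>W\<in>Pow (verts G).
     basis (abs_graph_class (induced G W), abs_graph_class (induced G (verts G - W)))"
proof -
  fix G H :: "nat pregraph"
  assume iso: "graph_iso G H"
  then obtain f where f: "graph_map f G H" and s: "simple_graph G" "simple_graph H"
    by (auto simp: graph_iso_def)
  have b: "bij_betw f (verts G) (verts H)" using f by (simp add: graph_map_def)
  have eq: "abs_graph_class (induced G W) = abs_graph_class (induced H (f ` W))"
    if "W \<subseteq> verts G" for W
    using graph_iso_induced[OF s f that] by (rule Quotient3_rel_abs[OF Quotient3_graph_class])
  show "(\<Sum>W\<in>Pow (verts G).
      basis (abs_graph_class (induced G W), abs_graph_class (induced G (verts G - W)))) =
    (\<Sum>W\<in>Pow (verts H).
      basis (abs_graph_class (induced H W), abs_graph_class (induced H (verts H - W))))"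
    using sum.reindex_bij_betw[OF bij_betw_induced(1)[OF b], of "\<lambda>W. basis
      (abs_graph_class (induced H W), abs_graph_class (induced H (verts H - W)))"]
    by (simp add: eq bij_betw_induced(2)[OF b])
qed

definition graph_coproduct :: "graph_algebra \<Rightarrow> graph_class \<times> graph_class \<Rightarrow>\<^sub>0 complex" where
  "graph_coproduct = lin_ext graph_coproduct_basis"

text \<open>A monomial is given by its exponents. Since the variables are numbered from 1, the exponent of
  the \<open>n\<close>-th variable is stored at position \<open>n - 1\<close>; position \<open>k\<close> has weight \<open>Suc k\<close>.\<close>

type_synonym mono = "nat \<Rightarrow>\<^sub>0 nat"
type_synonym polynomial = "mono \<Rightarrow>\<^sub>0 complex"

definition var_mono :: "nat \<Rightarrow> mono" where
  "var_mono n = Poly_Mapping.single (n - 1) 1"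

definition weight :: "mono \<Rightarrow> nat" where
  "weight m = (\<Sum>k\<in>Poly_Mapping.keys m. Suc k * Poly_Mapping.lookup m k)"

definition poly_coproduct :: "polynomial \<Rightarrow> mono \<times> mono \<Rightarrow>\<^sub>0 complex" where
  "poly_coproduct = lin_ext (\<lambda>m. \<Prod>k\<in>Poly_Mapping.keys m.
     (basis (var_mono (Suc k), 0) + basis (0, var_mono (Suc k))) ^ Poly_Mapping.lookup m k)"

lemma poly_coproduct_var:
  "poly_coproduct (basis (var_mono n)) = basis (var_mono n, 0) + basis (0, var_mono n)"
proof -
  have "scale 1 x = x" for x :: "mono \<times> mono \<Rightarrow>\<^sub>0 complex"
    by (rule poly_mapping_eqI) (simp add: lookup_scale)
  then show ?thesis
    by (simp add: poly_coproduct_def lin_ext_def var_mono_def)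
qed

text \<open>A bialgebra homomorphism between Hopf algebras automatically commutes with the antipodes.\<close>

definition umbral_invariant :: "(graph_algebra \<Rightarrow> polynomial) \<Rightarrow> bool" where
  "umbral_invariant I \<longleftrightarrow>
     Vector_Spaces.linear scale scale I \<and>
     I 1 = 1 \<and>
     (\<forall>x y. I (x * y) = I x * I y) \<and>
     (\<forall>x. counit (I x) = counit x) \<and>
     (\<forall>x. poly_coproduct (I x) = tensor_map I (graph_coproduct x)) \<and>
     (\<forall>n. I ` homogeneous num_verts n \<subseteq> homogeneous weight n)"


section \<open>Formal power series in infinitely many variables\<close>

type_synonym series = "mono \<Rightarrow> complex"

definition series_mult :: "series \<Rightarrow> series \<Rightarrow> series" where
  "series_mult F G m = (\<Sum>(a, b) \<in> {(a, b). a + b = m}. F a * G b)"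

primrec series_power :: "series \<Rightarrow> nat \<Rightarrow> series" where
  "series_power F 0 = (\<lambda>m. if m = 0 then 1 else 0)"
| "series_power F (Suc j) = series_mult F (series_power F j)"

text \<open>For a series without constant term, only the powers with exponent at most the total degree of
  \<open>m\<close> contribute to the coefficient of \<open>m\<close>.\<close>

definition series_exp :: "series \<Rightarrow> series" where
  "series_exp F m = Sum_any (\<lambda>j. series_power F j m / fact j)"

text \<open>Substitution of \<open>c n\<close> times the \<open>n\<close>-th variable for the \<open>n\<close>-th variable.\<close>

definition rescale :: "(nat \<Rightarrow> complex) \<Rightarrow> series \<Rightarrow> series" where
  "rescale c F m =
     F m * (\<Prod>k\<in>Poly_Mapping.keys m. c (Suc k) ^ Poly_Mapping.lookup m k)"

lemma weight_add: "weight (a + b) = weight a + weight b"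
proof -
  have *: "weight m = (\<Sum>k\<in>S. Suc k * Poly_Mapping.lookup m k)"
    if "finite S" "Poly_Mapping.keys m \<subseteq> S" for m S
    unfolding weight_def using that
    by (intro sum.mono_neutral_left) (auto simp: in_keys_iff)
  let ?S = "Poly_Mapping.keys a \<union> Poly_Mapping.keys b"
  have "weight (a + b) = (\<Sum>k\<in>?S. Suc k * Poly_Mapping.lookup (a + b) k)"
    by (rule *) (auto simp: in_keys_iff lookup_add)
  also have "\<dots> = (\<Sum>k\<in>?S. Suc k * Poly_Mapping.lookup a k) + (\<Sum>k\<in>?S. Suc k * Poly_Mapping.lookup b k)"
    by (simp only: lookup_add distrib_left sum.distrib)
  also have "\<dots> = weight a + weight b"
    using *[of ?S a] *[of ?S b] by simp
  finally show ?thesis .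
qed

lemma finite_weight_le: "finite {m. weight m \<le> n}"
proof -
  have bound: "k < n \<and> Poly_Mapping.lookup m k \<le> n"
    if "weight m \<le> n" "k \<in> Poly_Mapping.keys m" for m k
  proof -
    have "Suc k * Poly_Mapping.lookup m k \<le> weight m"
      unfolding weight_def by (rule member_le_sum) (use that in auto)
    moreover have "Suc k * 1 \<le> Suc k * Poly_Mapping.lookup m k"
      using that(2) by (intro mult_le_mono) (simp_all add: in_keys_iff)
    moreover have "1 * Poly_Mapping.lookup m k \<le> Suc k * Poly_Mapping.lookup m k"
      by (intro mult_le_mono) simp_all
    ultimately show ?thesis using that(1) unfolding mult_1 mult_1_right
      by (meson Suc_le_lessD le_trans)
  qed
  have "Poly_Mapping.lookup ` {m. weight m \<le> n} \<subseteq>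
      {f. \<forall>k. (k \<in> {..<n} \<longrightarrow> f k \<in> {..n}) \<and> (k \<notin> {..<n} \<longrightarrow> f k = 0)}"
  proof clarify
    fix m k assume "weight m \<le> n"
    then show "(k \<in> {..<n} \<longrightarrow> Poly_Mapping.lookup m k \<in> {..n}) \<and> (k \<notin> {..<n} \<longrightarrow> Poly_Mapping.lookup m k = 0)"
      using bound[of m k] by (cases "k \<in> Poly_Mapping.keys m") (auto simp: in_keys_iff)
  qed
  then have "finite (Poly_Mapping.lookup ` {m. weight m \<le> n})"
    by (rule finite_subset) (rule finite_set_of_finite_funs, auto)
  then show ?thesis
    by (rule finite_imageD) (auto simp: inj_on_def lookup_inject)
qed

lemma finite_mono_splits: "finite {(a, b). a + b = (m :: mono)}"
  by (rule finite_subset[of _ "{a. weight a \<le> weight m} \<times> {b. weight b \<le> weight m}"])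
    (auto simp: weight_add finite_weight_le)

lift_definition weight_part :: "nat \<Rightarrow> series \<Rightarrow> polynomial" is
  "\<lambda>n F m. if weight m = n then F m else 0"
  by (rule finite_subset[OF _ finite_weight_le]) auto


section \<open>One-part Schur polynomials and generating functions\<close>

text \<open>The series with \<open>p\<^sub>k / k\<close> as its terms, for \<open>k \<ge> 1\<close>.\<close>

definition power_sum_series :: series where
  "power_sum_series m = Sum_any (\<lambda>k. if k \<ge> 1 \<and> m = var_mono k then 1 / of_nat k else 0)"

definition schur_poly :: "nat \<Rightarrow> polynomial" where
  "schur_poly n = weight_part n (series_exp power_sum_series)"

definition schur_series :: series where
  "schur_series m = (if m = 0 then 1 else 0) +
     Sum_any (\<lambda>n. if n \<ge> 1 then 2 ^ (n * (n - 1) div 2) * Poly_Mapping.lookup (schur_poly n) m else 0)"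

text \<open>For an umbral invariant, only the finitely many graphs with \<^term>\<open>weight m\<close> vertices contribute
  to the coefficient of \<open>m\<close>; see \<open>finite_contributing_graphs\<close> below.\<close>

definition generating_function :: "(graph_algebra \<Rightarrow> polynomial) \<Rightarrow> series" where
  "generating_function I m =
     Sum_any (\<lambda>G. Poly_Mapping.lookup (I (basis G)) m / of_nat (aut_order G))"

definition i_const :: "(graph_algebra \<Rightarrow> polynomial) \<Rightarrow> nat \<Rightarrow> complex" where
  "i_const I n = fact n * Sum_any (\<lambda>G. if is_connected G
     then Poly_Mapping.lookup (I (basis G)) (var_mono n) / of_nat (aut_order G) else 0)"

lemma finite_num_verts: "finite {G. num_verts G = n}"
proof -
  let ?R = "{..<n} :: nat set"
  have "{G. num_verts G = n} \<subseteq> abs_graph_class ` ({?R} \<times> Pow (Pow ?R))"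
  proof (clarify)
    fix G assume n: "n = num_verts G"
    obtain A where A: "graph_iso A A" "G = abs_graph_class A"
      using Quotient3_abs_rep[OF Quotient3_graph_class] Quotient3_rep_reflp[OF Quotient3_graph_class]
      by metis
    have sA: "simple_graph A" using A by (simp add: graph_iso_def)
    have "card (verts A) = n"
      using A n num_verts.abs_eq by simp
    then obtain f where f: "bij_betw f (verts A) ?R"
      using sA by (metis card_lessThan finite_lessThan finite_same_card_bij simple_graph_def)
    define B where "B = (?R, (`) f ` edges A)"
    have "simple_graph (f ` verts A, (`) f ` edges A)"
      using sA f by (intro simple_graph_map) (auto simp: bij_betw_def)
    then have sB: "simple_graph B" using f by (simp add: B_def bij_betw_def)
    have "graph_iso A B"
      using sA sB f unfolding graph_iso_def graph_map_def B_def by auto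
    then have "G = abs_graph_class B"
      using A Quotient3_rel_abs[OF Quotient3_graph_class] by blast
    moreover have "B \<in> {?R} \<times> Pow (Pow ?R)"
      using sB by (auto simp: simple_graph_def B_def)
    ultimately show "G \<in> abs_graph_class ` ({{..<num_verts G}} \<times> Pow (Pow {..<num_verts G}))" 
      using n by auto
  qed
  then show ?thesis by (rule finite_subset) auto
qed

lemma finite_contributing_graphs:
  assumes "umbral_invariant I"
  shows "finite {G. Poly_Mapping.lookup (I (basis G)) m \<noteq> 0}"
proof (rule finite_subset[OF _ finite_num_verts[of "weight m"]], clarify)
  fix G assume "Poly_Mapping.lookup (I (basis G)) m \<noteq> 0"
  moreover have "I (basis G) \<in> homogeneous weight (num_verts G)"
    using assms unfolding umbral_invariant_def homogeneous_def by (force simp: image_subset_iff)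
  ultimately show "num_verts G = weight m"
    by (auto simp: homogeneous_def in_keys_iff)
qed

end

theory Submission
  imports Defs
begin

text \<open>
  Let \<open>e\<^sub>n\<close> be the sum, in the graph algebra, of all \<open>2 ^ (n choose 2)\<close> labelled graphs on \<open>n\<close>
  vertices. By the orbit-stabiliser theorem (\<open>labelled_sum_eq_sum_classes\<close>), the sum of
  \<open>G / |Aut(G)|\<close> over the isomorphism classes with \<open>n\<close> vertices is \<open>e\<^sub>n / n!\<close>. A pair of labelled
  graphs on the two parts of a partition of the vertices into sets of \<open>k\<close> and \<open>l\<close> elements is the
  restriction of \<open>2 ^ (k l)\<close> labelled graphs on the union, so the coproduct of \<open>e\<^sub>n\<close> is
  \<open>\<Sum>\<^sub>k (n choose k) 2 ^ (k (n - k)) e\<^sub>k \<otimes> e\<^sub>n\<^sub>-\<^sub>k\<close>. Since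
  \<open>(k + l choose 2) = (k choose 2) + (l choose 2) + k l\<close>, the formal sum of the elements
  \<open>e\<^sub>n / (n! 2 ^ (n choose 2))\<close> is group-like.

  An umbral invariant maps it to a group-like power series, whose coefficients \<open>c m\<close> satisfy
  \<open>(a + b)! c (a + b) = (a! c a) (b! c b)\<close> for all monomials \<open>a\<close> and \<open>b\<close>, where \<open>m!\<close> is the product of
  the factorials of the exponents (\<open>normalised_coeff_add\<close>). Hence the series is the exponential of its
  linear part \<open>\<Sum>\<^sub>n a\<^sub>n q\<^sub>n\<close>, and the part of the generating function of weight \<open>n\<close> is
  \<open>2 ^ (n choose 2)\<close> times the part of this exponential of weight \<open>n\<close>.

  It remains to identify \<open>a\<^sub>n\<close>. The invariant of a disjoint union of nonempty graphs is a product of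
  polynomials without constant term, so only connected graphs contribute to the coefficient of \<open>q\<^sub>n\<close>,
  and \<open>a\<^sub>n = i\<^sub>n / (n! 2 ^ (n choose 2))\<close> (\<open>i_const_eq\<close>). The rescaling of the variables turns
  \<open>a\<^sub>n q\<^sub>n\<close> into \<open>p\<^sub>n / n\<close>, and the exponential of the sum of these terms is the series of
  one-part Schur polynomials.
\<close>


section \<open>Monomials\<close>

text \<open>The coefficient of a monomial in a polynomial, and likewise the exponent of a variable in a
  monomial.\<close>

abbreviation coeff :: "('a \<Rightarrow>\<^sub>0 'b::zero) \<Rightarrow> 'a \<Rightarrow> 'b" where
  "coeff \<equiv> Poly_Mapping.lookup"

text \<open>The variables numbered from 0 as in the encoding of monomials: \<open>var k\<close> is the monomial that
  consists of the variable of weight \<open>k + 1\<close>, that is, \<^term>\<open>var_mono (Suc k)\<close>.\<close>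

abbreviation var :: "nat \<Rightarrow> mono" where
  "var k \<equiv> Poly_Mapping.single k (Suc 0)"

text \<open>The value of a monomial when \<open>w k\<close> is substituted for \<open>var k\<close>, the product of the factorials of
  its exponents, and its total degree (in which every variable counts 1).\<close>

definition mono_eval :: "(nat \<Rightarrow> 'a::comm_monoid_mult) \<Rightarrow> mono \<Rightarrow> 'a" where
  "mono_eval w m = (\<Prod>k\<in>Poly_Mapping.keys m. w k ^ coeff m k)"

definition mono_fact :: "mono \<Rightarrow> complex" where
  "mono_fact m = (\<Prod>k\<in>Poly_Mapping.keys m. fact (coeff m k))"

definition mono_deg :: "mono \<Rightarrow> nat" where
  "mono_deg m = (\<Sum>k\<in>Poly_Mapping.keys m. coeff m k)"

lemma mono_eval_superset:
  "finite S \<Longrightarrow> Poly_Mapping.keys m \<subseteq> S \<Longrightarrow> mono_eval w m = (\<Prod>k\<in>S. w k ^ coeff m k)"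
  unfolding mono_eval_def by (rule prod.mono_neutral_left) (auto simp: in_keys_iff)

lemma mono_fact_superset:
  "finite S \<Longrightarrow> Poly_Mapping.keys m \<subseteq> S \<Longrightarrow> mono_fact m = (\<Prod>k\<in>S. fact (coeff m k))"
  unfolding mono_fact_def by (rule prod.mono_neutral_left) (auto simp: in_keys_iff)

lemma mono_deg_superset:
  "finite S \<Longrightarrow> Poly_Mapping.keys m \<subseteq> S \<Longrightarrow> mono_deg m = (\<Sum>k\<in>S. coeff m k)"
  unfolding mono_deg_def by (rule sum.mono_neutral_left) (auto simp: in_keys_iff)

lemma keys_add_var: "Poly_Mapping.keys (m + var k) = insert k (Poly_Mapping.keys m)"
  by (auto simp: in_keys_iff lookup_add lookup_single when_def split: if_splits)

lemma coeff_add_var: "coeff (m + var k) j = coeff m j + (if j = k then 1 else 0)"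
  by (simp add: lookup_add lookup_single when_def)

lemma mono_eval_0 [simp]: "mono_eval w 0 = 1"
  and mono_fact_0 [simp]: "mono_fact 0 = 1"
  and mono_deg_0 [simp]: "mono_deg 0 = 0"
  and weight_0 [simp]: "weight 0 = 0"
  by (simp_all add: mono_eval_def mono_fact_def mono_deg_def weight_def)

lemma weight_var [simp]: "weight (var k) = Suc k"
  by (simp add: weight_def)

lemma mono_eval_add: "mono_eval w (a + b) = mono_eval w a * mono_eval w b"
proof -
  let ?S = "Poly_Mapping.keys a \<union> Poly_Mapping.keys b"
  have "Poly_Mapping.keys (a + b) \<subseteq> ?S"
    by (rule keys_add)
  then show ?thesis
    by (simp add: mono_eval_superset[of ?S] lookup_add power_add prod.distrib)
qed

lemma mono_eval_var [simp]: "mono_eval w (var k) = w k"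
  by (simp add: mono_eval_def)

lemma mono_deg_add: "mono_deg (a + b) = mono_deg a + mono_deg b"
proof -
  let ?S = "Poly_Mapping.keys a \<union> Poly_Mapping.keys b"
  have "Poly_Mapping.keys (a + b) \<subseteq> ?S"
    by (rule keys_add)
  then show ?thesis
    by (simp add: mono_deg_superset[of ?S] lookup_add sum.distrib)
qed

lemma mono_deg_var [simp]: "mono_deg (var k) = Suc 0"
  by (simp add: mono_deg_def)

lemma mono_fact_add_var: "mono_fact (m + var k) = of_nat (Suc (coeff m k)) * mono_fact m"
proof -
  let ?S = "insert k (Poly_Mapping.keys m)"
  have "mono_fact (m + var k) = (\<Prod>j\<in>?S. fact (coeff (m + var k) j))"
    by (subst mono_fact_superset[of ?S]) (auto simp only: keys_add_var finite_keys finite_insert)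
  also have "\<dots> = (\<Prod>j\<in>?S. (if j = k then of_nat (Suc (coeff m k)) else 1) * fact (coeff m j))"
    by (rule prod.cong) (auto simp: coeff_add_var algebra_simps)
  also have "\<dots> = of_nat (Suc (coeff m k)) * mono_fact m"
    by (simp only: prod.distrib prod.delta finite_insert finite_keys)
      (simp add: mono_fact_superset[of ?S m] subset_insertI)
  finally show ?thesis .
qed

lemma mono_fact_nonzero [simp]: "mono_fact m \<noteq> 0"
  by (simp add: mono_fact_def)

lemma weight_eq_0_iff [simp]: "weight m = 0 \<longleftrightarrow> m = 0"
  by (auto simp: weight_def in_keys_iff intro!: poly_mapping_eqI)

lemma mono_split_var:
  assumes "coeff m k \<noteq> 0"
  shows "m - var k + var k = m"
  using assms by (intro poly_mapping_eqI) (auto simp: lookup_add lookup_minus lookup_single when_def)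

lemma mono_add_diff_var:
  assumes "coeff m k \<noteq> 0"
  shows "l + (m - var k) + var k = l + m"
  unfolding add.assoc mono_split_var[OF assms] ..

lemma var_eq_iff [simp]: "var j = var k \<longleftrightarrow> j = k"
  using weight_var by (metis Suc_inject)

lemma mono_induct [case_names zero add]:
  assumes "P 0" and "\<And>m k. P m \<Longrightarrow> P (m + var k)"
  shows "P m"
proof (induction "weight m" arbitrary: m rule: less_induct)
  case less
  show ?case
  proof (cases "m = 0")
    case True
    then show ?thesis using assms(1) by simp
  next
    case False
    then obtain k where k: "coeff m k \<noteq> 0"
      by (metis poly_mapping_eqI lookup_zero)
    then have "weight (m - var k) < weight m"
      using weight_add[of "m - var k" "var k"] by (simp add: mono_split_var)
    then show ?thesis
      using less assms(2)[of "m - var k" k] mono_split_var[OF k] by simp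
  qed
qed


section \<open>The coproduct of polynomials\<close>

lemma coeff_lin_ext:
  "coeff (lin_ext f x) b = (\<Sum>a\<in>Poly_Mapping.keys x. coeff x a * coeff (f a) b)"
  by (simp add: lin_ext_def lookup_sum lookup_scale)

lemma coeff_lin_ext_superset:
  assumes "finite S" "Poly_Mapping.keys x \<subseteq> S"
  shows "coeff (lin_ext f x) b = (\<Sum>a\<in>S. coeff x a * coeff (f a) b)"
  unfolding coeff_lin_ext using assms
  by (intro sum.mono_neutral_left) (auto simp: in_keys_iff)

lemma lin_ext_add: "lin_ext f (x + y) = lin_ext f x + lin_ext f y"
proof (rule poly_mapping_eqI)
  fix b
  let ?S = "Poly_Mapping.keys x \<union> Poly_Mapping.keys y"
  show "coeff (lin_ext f (x + y)) b = coeff (lin_ext f x + lin_ext f y) b"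
    using keys_add[of x y]
    by (simp add: coeff_lin_ext_superset[of ?S] lookup_add algebra_simps sum.distrib)
qed

lemma lin_ext_0 [simp]: "lin_ext f 0 = 0"
  by (simp add: lin_ext_def)

lemma lin_ext_sum: "lin_ext f (\<Sum>i\<in>A. x i) = (\<Sum>i\<in>A. lin_ext f (x i))"
  by (induction A rule: infinite_finite_induct) (simp_all add: lin_ext_add)

lemma lin_ext_basis [simp]: "lin_ext f (basis a) = f a"
  by (rule poly_mapping_eqI) (simp add: coeff_lin_ext)

lemma coeff_tensor: "coeff (tensor x y) (a, b) = coeff x a * coeff y b"
proof -
  have "coeff (tensor x y) (a, b) = (\<Sum>a'\<in>Poly_Mapping.keys x. if a' = a then
      \<Sum>b'\<in>Poly_Mapping.keys y. if b' = b then coeff x a * coeff y b else 0 else 0)"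
    unfolding tensor_def lookup_sum
    by (intro sum.cong refl) (auto simp: lookup_single when_def intro!: sum.cong sum.neutral)
  also have "\<dots> = coeff x a * coeff y b"
    by (simp add: sum.delta in_keys_iff)
  finally show ?thesis .
qed

lemma coeff_mult_basis:
  fixes p :: "'a::cancel_comm_monoid_add \<Rightarrow>\<^sub>0 complex"
  shows "coeff (p * basis s) t = Sum_any (\<lambda>l. if t = l + s then coeff p l else 0)"
proof -
  have "(coeff (basis s) q when t = l + q) = (if q = s then (1 when t = l + s) else (0::complex))"
    for q l by (auto simp: lookup_single when_def)
  then show ?thesis
    by (simp add: lookup_mult when_def cong: if_cong)
      (auto intro: Sum_any.cong)
qed

lemma coeff_mult_basis_add [simp]:
  fixes p :: "'a::cancel_comm_monoid_add \<Rightarrow>\<^sub>0 complex"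
  shows "coeff (p * basis s) (l + s) = coeff p l"
  by (simp add: coeff_mult_basis)

lemma coeff_mult_basis_eq_0:
  fixes p :: "'a::cancel_comm_monoid_add \<Rightarrow>\<^sub>0 complex"
  assumes "\<And>l. t \<noteq> l + s"
  shows "coeff (p * basis s) t = 0"
  using assms by (simp add: coeff_mult_basis)

text \<open>The coproduct of a monomial, the image under the multiplicative extension of
  \<open>var k \<mapsto> var k \<otimes> 1 + 1 \<otimes> var k\<close>.\<close>

definition mono_coproduct :: "mono \<Rightarrow> mono \<times> mono \<Rightarrow>\<^sub>0 complex" where
  "mono_coproduct = mono_eval (\<lambda>k. basis (var k, 0) + basis (0, var k))"

lemma poly_coproduct_eq: "poly_coproduct = lin_ext mono_coproduct"
  by (simp add: poly_coproduct_def mono_coproduct_def mono_eval_def[abs_def] var_mono_def)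

lemma coeff_mult_basis_var_left:
  fixes a b :: mono
  shows "coeff (p * basis (var k, 0)) (a, b) = (if coeff a k = 0 then 0 else coeff p (a - var k, b))"
proof (cases "coeff a k = 0")
  case True
  then have "(a, b) \<noteq> l + (var k, 0)" for l
    by (cases l) (auto simp: lookup_add)
  then show ?thesis
    unfolding if_P[OF True] by (intro coeff_mult_basis_eq_0)
next
  case False
  then show ?thesis
    using coeff_mult_basis_add[of p "(var k, 0)" "(a - var k, b)"] by (simp add: mono_split_var)
qed

lemma coeff_mult_basis_var_right:
  fixes a b :: mono
  shows "coeff (p * basis (0, var k)) (a, b) = (if coeff b k = 0 then 0 else coeff p (a, b - var k))"
proof (cases "coeff b k = 0")
  case True
  then have "(a, b) \<noteq> l + (0, var k)" for l
    by (cases l) (auto simp: lookup_add)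
  then show ?thesis
    unfolding if_P[OF True] by (intro coeff_mult_basis_eq_0)
next
  case False
  then show ?thesis
    using coeff_mult_basis_add[of p "(0, var k)" "(a, b - var k)"] by (simp add: mono_split_var)
qed

lemma mono_fact_split_var:
  "coeff m k \<noteq> 0 \<Longrightarrow> mono_fact m = of_nat (coeff m k) * mono_fact (m - var k)"
  using mono_fact_add_var[of "m - var k" k]
  by (simp add: mono_split_var lookup_minus del: of_nat_Suc)

text \<open>The coefficient is a product of binomial coefficients. Multiplying by the factorials avoids
  the division, and the induction step becomes Pascal's rule in the form
  \<^term>\<open>coeff a k + coeff b k = Suc (coeff m k)\<close>.\<close>

lemma coeff_mono_coproduct:
  "mono_fact a * mono_fact b * coeff (mono_coproduct m) (a, b) =
     (if a + b = m then mono_fact m else 0)"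
proof (induction m arbitrary: a b rule: mono_induct)
  case zero
  have "a + b = 0 \<longleftrightarrow> a = 0 \<and> b = 0"
    using weight_eq_0_iff[of "a + b"] by (simp add: weight_add del: weight_eq_0_iff) simp
  then show ?case
    by (auto simp: mono_coproduct_def lookup_one when_def zero_prod_def)
next
  case (add m k)
  let ?D = "coeff (mono_coproduct m)"
  have D: "coeff (mono_coproduct (m + var k)) (a, b) =
      (if coeff a k = 0 then 0 else ?D (a - var k, b)) + (if coeff b k = 0 then 0 else ?D (a, b - var k))"
    by (simp add: mono_coproduct_def mono_eval_add distrib_left lookup_add
        coeff_mult_basis_var_left coeff_mult_basis_var_right)
  have left: "mono_fact a * mono_fact b * (if coeff a k = 0 then 0 else ?D (a - var k, b)) =
      (if a + b = m + var k then of_nat (coeff a k) * mono_fact m else 0)"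
  proof (cases "coeff a k = 0")
    case False
    then have "a - var k + b = m \<longleftrightarrow> a + b = m + var k"
      using mono_add_diff_var[OF False, of b] by (metis add.commute add_right_cancel)
    then show ?thesis
      using add.IH[of "a - var k" b] mono_fact_split_var[OF False] False by (auto simp: mult.assoc)
  qed simp
  have right: "mono_fact a * mono_fact b * (if coeff b k = 0 then 0 else ?D (a, b - var k)) =
      (if a + b = m + var k then of_nat (coeff b k) * mono_fact m else 0)"
  proof (cases "coeff b k = 0")
    case False
    then have "a + (b - var k) = m \<longleftrightarrow> a + b = m + var k"
      using mono_add_diff_var[OF False, of a] by (metis add_right_cancel)
    then show ?thesis
      using add.IH[of a "b - var k"] mono_fact_split_var[OF False] False
      by (auto simp: mult.assoc mult.left_commute)
  qed simp
  have "coeff a k + coeff b k = Suc (coeff m k)" if "a + b = m + var k"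
    using arg_cong[OF that, of "\<lambda>x. coeff x k"] by (simp add: lookup_add)
  then have sum: "of_nat (coeff a k) + of_nat (coeff b k) = (of_nat (Suc (coeff m k)) :: complex)"
    if "a + b = m + var k"
    using that by (simp only: flip: of_nat_add)
  show ?case
  proof (cases "a + b = m + var k")
    case True
    then show ?thesis
      unfolding D distrib_left left right if_P[OF True]
      by (simp only: mono_fact_add_var sum[OF True] flip: distrib_right)
  next
    case False
    then show ?thesis
      unfolding D distrib_left left right if_not_P[OF False] by simp
  qed
qed

lemma coeff_poly_coproduct:
  "mono_fact a * mono_fact b * coeff (poly_coproduct p) (a, b) =
     mono_fact (a + b) * coeff p (a + b)"
proof -
  have "mono_fact a * mono_fact b * coeff (poly_coproduct p) (a, b) =
      (\<Sum>m\<in>Poly_Mapping.keys p. coeff p m *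
         (mono_fact a * mono_fact b * coeff (mono_coproduct m) (a, b)))"
    by (simp add: poly_coproduct_eq coeff_lin_ext sum_distrib_left mult_ac)
  also have "\<dots> = (\<Sum>m\<in>Poly_Mapping.keys p. if m = a + b then mono_fact m * coeff p m else 0)"
    unfolding coeff_mono_coproduct by (intro sum.cong) auto
  also have "\<dots> = mono_fact (a + b) * coeff p (a + b)"
    by (simp add: sum.delta in_keys_iff)
  finally show ?thesis .
qed


section \<open>Exponentials of linear series and the Schur polynomials\<close>

text \<open>The series \<open>\<Sum>\<^sub>k w k \<cdot> var k\<close>; the monomials of total degree 1 are exactly the variables.\<close>

definition linear_series :: "(nat \<Rightarrow> complex) \<Rightarrow> series" where
  "linear_series w m = (if mono_deg m = 1 then mono_eval w m else 0)"

lemma mono_deg_eq_0_iff: "mono_deg m = 0 \<longleftrightarrow> m = 0"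
  by (auto simp: mono_deg_def in_keys_iff intro!: poly_mapping_eqI)

lemma mono_deg_eq_1_imp: 
  assumes "mono_deg m = Suc 0" obtains k where "m = var k"
proof -
  obtain k where k: "coeff m k \<noteq> 0"
    using assms by (metis mono_deg_0 nat.distinct(1) poly_mapping_eqI lookup_zero)
  have "mono_deg (m - var k) = 0"
    using assms mono_deg_add[of "m - var k" "var k"] by (simp add: mono_split_var[OF k])
  then have "m = var k"
    using mono_split_var[OF k] by (simp add: mono_deg_eq_0_iff)
  then show thesis by (rule that)
qed

lemma series_mult_linear:
  "series_mult (linear_series w) P m = (\<Sum>k\<in>Poly_Mapping.keys m. w k * P (m - var k))"
proof -
  let ?g = "\<lambda>k. (var k, m - var k)"
  have "series_mult (linear_series w) P m =
      (\<Sum>(a, b)\<in>?g ` Poly_Mapping.keys m. linear_series w a * P b)"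
    unfolding series_mult_def
  proof (rule sum.mono_neutral_right[OF finite_mono_splits])
    show "?g ` Poly_Mapping.keys m \<subseteq> {(a, b). a + b = m}"
      using mono_split_var[of m] by (auto simp: in_keys_iff add.commute)
    show "\<forall>x\<in>{(a, b). a + b = m} - ?g ` Poly_Mapping.keys m. (case x of (a, b) \<Rightarrow> linear_series w a * P b) = 0"
    proof (intro ballI)
      fix x assume x: "x \<in> {(a, b). a + b = m} - ?g ` Poly_Mapping.keys m"
      then obtain a b where ab: "x = (a, b)" and m: "m = a + b" by auto
      have "mono_deg a \<noteq> 1"
      proof
        assume "mono_deg a = 1"
        then obtain k where "a = var k" by (auto elim: mono_deg_eq_1_imp)
        then have "k \<in> Poly_Mapping.keys (a + b)" "(a, b) = (var k, a + b - var k)"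
          by (simp_all add: in_keys_iff lookup_add)
        then have "x \<in> ?g ` Poly_Mapping.keys m"
          unfolding ab m by (rule rev_image_eqI)
        then show False using x by blast
      qed
      then show "(case x of (a, b) \<Rightarrow> linear_series w a * P b) = 0"
        by (simp add: ab linear_series_def)
    qed
  qed
  also have "\<dots> = (\<Sum>k\<in>Poly_Mapping.keys m. w k * P (m - var k))"
    by (subst sum.reindex) (auto simp: inj_on_def linear_series_def)
  finally show ?thesis .
qed

text \<open>The multinomial theorem.\<close>

lemma series_power_linear:
  "series_power (linear_series w) j m =
     (if mono_deg m = j then fact j * mono_eval w m / mono_fact m else 0)"
proof (induction j arbitrary: m)
  case 0
  then show ?case by (simp add: mono_deg_eq_0_iff)
next
  case (Suc j)
  have step: "w k * series_power (linear_series w) j (m - var k) =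
      (if mono_deg m = Suc j then fact j * mono_eval w m / mono_fact m * of_nat (coeff m k) else 0)"
    if k: "k \<in> Poly_Mapping.keys m" for k
  proof -
    have k': "coeff m k \<noteq> 0" using k by (simp add: in_keys_iff)
    have "mono_eval w m = mono_eval w (m - var k) * w k"
      using mono_eval_add[of w "m - var k" "var k"] by (simp add: mono_split_var[OF k'])
    moreover have "mono_deg m = Suc (mono_deg (m - var k))"
      using mono_deg_add[of "m - var k" "var k"] by (simp add: mono_split_var[OF k'])
    ultimately show ?thesis
      using k' by (simp add: Suc.IH mono_fact_split_var[OF k'])
  qed
  have "series_power (linear_series w) (Suc j) m = (\<Sum>k\<in>Poly_Mapping.keys m.
      if mono_deg m = Suc j then fact j * mono_eval w m / mono_fact m * of_nat (coeff m k) else 0)"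
    by (simp only: series_power.simps series_mult_linear step cong: sum.cong)
  also have "\<dots> =
      (if mono_deg m = Suc j then fact j * mono_eval w m / mono_fact m * of_nat (mono_deg m) else 0)"
  proof (cases "mono_deg m = Suc j")
    case True
    show ?thesis
      unfolding if_P[OF True] by (simp only: mono_deg_def of_nat_sum sum_distrib_left)
  qed simp
  finally show ?case by simp
qed

lemma series_exp_linear: "series_exp (linear_series w) m = mono_eval w m / mono_fact m"
proof -
  have "series_power (linear_series w) j m / fact j =
      (if j = mono_deg m then mono_eval w m / mono_fact m else 0)" for j
    by (simp add: series_power_linear)
  then show ?thesis
    by (simp only: series_exp_def Sum_any.delta)
qed

lemma power_sum_series_eq: "power_sum_series = linear_series (\<lambda>k. 1 / of_nat (Suc k))"
proof
  fix m
  show "power_sum_series m = linear_series (\<lambda>k. 1 / of_nat (Suc k)) m"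
  proof (cases "mono_deg m = Suc 0")
    case True
    then obtain k where m: "m = var k" by (rule mono_deg_eq_1_imp)
    have eq: "(if j \<ge> 1 \<and> m = var_mono j then 1 / of_nat j else 0) =
        (if j = Suc k then 1 / of_nat j else (0::complex))" for j
      by (auto simp: m var_mono_def)
    show ?thesis
      unfolding power_sum_series_def eq Sum_any.delta
      by (simp add: m linear_series_def)
  next
    case False
    then have "m \<noteq> var_mono j" for j by (auto simp: var_mono_def)
    then show ?thesis using False by (simp add: power_sum_series_def linear_series_def)
  qed
qed

lemma schur_series_eq:
  "schur_series m =
     2 ^ (weight m * (weight m - 1) div 2) * mono_eval (\<lambda>k. 1 / of_nat (Suc k)) m / mono_fact m"
proof -
  have eq: "(if n \<ge> 1 then 2 ^ (n * (n - 1) div 2) * coeff (schur_poly n) m else 0) =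
      (if n = weight m then if m = 0 then 0 else 2 ^ (weight m * (weight m - 1) div 2) *
         mono_eval (\<lambda>k. 1 / of_nat (Suc k)) m / mono_fact m else 0)" for n
    by (auto simp: schur_poly_def weight_part.rep_eq power_sum_series_eq series_exp_linear Suc_le_eq)
  show ?thesis
    unfolding schur_series_def eq Sum_any.delta by simp
qed


section \<open>Sums over labelled graphs\<close>

text \<open>All possible edges on the vertex set \<open>V\<close>.\<close>

definition pairs :: "'a set \<Rightarrow> 'a set set" where
  "pairs V = {e. e \<subseteq> V \<and> card e = 2}"

text \<open>The sum over all labelled graphs on \<open>V\<close> of a quantity that depends on the isomorphism class
  only.\<close>

definition labelled_sum :: "(graph_class \<Rightarrow> complex) \<Rightarrow> nat set \<Rightarrow> complex" where
  "labelled_sum f V = (\<Sum>E\<in>Pow (pairs V). f (abs_graph_class (V, E)))"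

lemma finite_pairs [simp]: "finite V \<Longrightarrow> finite (pairs V)"
  unfolding pairs_def by (rule finite_subset[of _ "Pow V"]) auto

lemma simple_graph_iff: "simple_graph (V, E) \<longleftrightarrow> finite V \<and> E \<in> Pow (pairs V)"
  by (auto simp: simple_graph_def pairs_def)

lemma abs_graph_class_eq_iff:
  assumes "simple_graph G" "simple_graph H"
  shows "abs_graph_class G = abs_graph_class H \<longleftrightarrow> graph_iso G H"
  using Quotient3_rel[OF Quotient3_graph_class, of G H] assms by (auto intro: graph_iso_refl)

lemma graph_class_cases:
  obtains A where "simple_graph A" "G = abs_graph_class A"
  by (metis Quotient3_abs_rep[OF Quotient3_graph_class] Quotient3_rep_reflp[OF Quotient3_graph_class]
      graph_iso_def)

lemma num_verts_abs: "simple_graph A \<Longrightarrow> num_verts (abs_graph_class A) = card (verts A)"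
  by (rule num_verts.abs_eq[OF graph_iso_refl])

lemma bij_betw_pairs:
  assumes "bij_betw f V W"
  shows "bij_betw ((`) f) (pairs V) (pairs W)"
proof -
  have b: "bij_betw ((`) f) (Pow V) (Pow W)" by (rule bij_betw_Pow[OF assms])
  have card: "card (f ` e) = card e" if "e \<subseteq> V" for e
    using assms that by (meson bij_betw_def card_image inj_on_subset)
  have "(`) f ` pairs V = pairs W"
  proof (intro equalityI subsetI)
    fix e assume "e \<in> pairs W"
    then have "e \<in> (`) f ` Pow V" "card e = 2"
      using b by (auto simp: pairs_def bij_betw_def)
    then show "e \<in> (`) f ` pairs V"
      using card by (auto simp: pairs_def)
  qed (use card assms in \<open>auto simp: pairs_def bij_betw_def\<close>)
  moreover have "inj_on ((`) f) (pairs V)"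
    by (rule inj_on_subset[OF bij_betw_imp_inj_on[OF b]]) (auto simp: pairs_def)
  ultimately show ?thesis
    by (simp add: bij_betw_def)
qed

lemma graph_iso_image:
  assumes "bij_betw f V W" "simple_graph (V, E)"
  shows "graph_iso (V, E) (W, (`) f ` E)"
  using assms simple_graph_map[of "(V, E)" f]
  by (auto simp: graph_iso_def graph_map_def bij_betw_def)

lemma graph_class_on_cases:
  assumes "finite V" "card V = num_verts G"
  obtains E where "simple_graph (V, E)" "G = abs_graph_class (V, E)"
proof -
  obtain A where A: "simple_graph A" "G = abs_graph_class A" by (rule graph_class_cases)
  have "finite (verts A)" "card (verts A) = card V"
    using A assms by (auto simp: num_verts_abs simple_graph_def)
  then obtain f where f: "bij_betw f (verts A) V"
    using assms(1) finite_same_card_bij by blast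
  have "graph_iso (verts A, edges A) (V, (`) f ` edges A)"
    using f A(1) by (intro graph_iso_image) auto
  moreover from this have "simple_graph (V, (`) f ` edges A)" by (simp add: graph_iso_def)
  ultimately show thesis
    using that abs_graph_class_eq_iff A by (metis prod.collapse)
qed

lemma labelled_sum_cong_card:
  assumes "finite V" "finite W" "card V = card W"
  shows "labelled_sum f V = labelled_sum f W"
proof -
  obtain g where g: "bij_betw g V W"
    using assms finite_same_card_bij by blast
  have "bij_betw ((`) ((`) g)) (Pow (pairs V)) (Pow (pairs W))"
    by (intro bij_betw_Pow bij_betw_pairs g)
  then have "labelled_sum f W = (\<Sum>E\<in>Pow (pairs V). f (abs_graph_class (W, (`) g ` E)))"
    unfolding labelled_sum_def by (rule sum.reindex_bij_betw[symmetric])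
  also have "\<dots> = labelled_sum f V"
    unfolding labelled_sum_def
  proof (intro sum.cong refl arg_cong[of _ _ f])
    fix E assume "E \<in> Pow (pairs V)"
    then have "graph_iso (V, E) (W, (`) g ` E)"
      using g assms(1) by (intro graph_iso_image) (auto simp: simple_graph_iff)
    then show "abs_graph_class (W, (`) g ` E) = abs_graph_class (V, E)"
      by (metis Quotient3_rel_abs[OF Quotient3_graph_class])
  qed
  finally show ?thesis ..
qed

text \<open>Orbit-stabiliser for the permutations of the vertices acting on the labelled graphs: the orbit
  of a graph consists of its isomorphic copies on the same vertices, and the stabiliser is the
  automorphism group.\<close>

lemma card_labellings:
  assumes "simple_graph (V, E)"
  shows "card {F \<in> Pow (pairs V). graph_iso (V, E) (V, F)} * card (automorphisms (V, E)) =
    fact (card V)"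
proof -
  let ?P = "{\<pi>. \<pi> permutes V}" and ?O = "{F \<in> Pow (pairs V). graph_iso (V, E) (V, F)}"
  let ?act = "\<lambda>\<pi>. (`) \<pi> ` E"
  have fin: "finite V" using assms by (simp add: simple_graph_iff)
  have act: "?act \<pi> \<in> ?O" if "\<pi> permutes V" for \<pi>
  proof -
    have "graph_iso (V, E) (V, ?act \<pi>)"
      using graph_iso_image[OF permutes_imp_bij[OF that] assms] .
    then show ?thesis
      by (auto simp: graph_iso_def simple_graph_iff)
  qed
  have fibre: "card {\<pi> \<in> ?P. ?act \<pi> = F} = card (automorphisms (V, E))" if "F \<in> ?O" for F
  proof -
    from that obtain f where f: "bij_betw f V V" "(`) f ` E = F"
      by (auto simp: graph_iso_def graph_map_def)
    \<comment> \<open>The isomorphism is extended by the identity to a permutation; left multiplication by it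
      identifies the stabiliser with the fibre.\<close>
    define \<rho> where "\<rho> x = (if x \<in> V then f x else x)" for x
    have \<rho>: "\<rho> permutes V"
      by (rule bij_imp_permutes) (use f(1) in \<open>auto simp: \<rho>_def cong: bij_betw_cong\<close>)
    have "\<rho> ` e = f ` e" if "e \<in> E" for e
      using assms that by (intro image_cong) (auto simp: simple_graph_iff pairs_def \<rho>_def)
    then have act_\<rho>: "?act \<rho> = F"
      unfolding f(2)[symmetric] by (rule image_cong[OF refl])
    have inv: "\<rho> \<circ> inv \<rho> = id" "inv \<rho> \<circ> \<rho> = id"
      using permutes_inv_o[OF \<rho>] by auto
    have "bij_betw (\<lambda>\<sigma>. \<rho> \<circ> \<sigma>) (automorphisms (V, E)) {\<pi> \<in> ?P. ?act \<pi> = F}"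
    proof (rule bij_betw_byWitness[where f' = "\<lambda>\<pi>. inv \<rho> \<circ> \<pi>"])
      show "\<forall>\<sigma>\<in>automorphisms (V, E). inv \<rho> \<circ> (\<rho> \<circ> \<sigma>) = \<sigma>"
        by (simp add: inv flip: comp_assoc)
      show "\<forall>\<pi>\<in>{\<pi> \<in> ?P. ?act \<pi> = F}. \<rho> \<circ> (inv \<rho> \<circ> \<pi>) = \<pi>"
        by (simp add: inv flip: comp_assoc)
      have comp: "?act (\<alpha> \<circ> \<beta>) = (`) \<alpha> ` ?act \<beta>" for \<alpha> \<beta> :: "'a \<Rightarrow> 'a"
        by (simp add: image_image image_comp[symmetric])
      show "(\<lambda>\<sigma>. \<rho> \<circ> \<sigma>) ` automorphisms (V, E) \<subseteq> {\<pi> \<in> ?P. ?act \<pi> = F}"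
        using permutes_compose[OF _ \<rho>] act_\<rho> unfolding automorphisms_def
        by (auto simp only: comp image_subset_iff mem_Collect_eq fst_conv snd_conv)
      have "(`) (inv \<rho>) ` F = E"
        using comp[of "inv \<rho>" \<rho>] by (simp add: inv act_\<rho>)
      then have "inv \<rho> \<circ> \<pi> \<in> automorphisms (V, E)" if "\<pi> permutes V" "?act \<pi> = F" for \<pi>
        using that permutes_compose[OF that(1) permutes_inv[OF \<rho>]]
        by (simp add: automorphisms_def comp del: o_apply)
      then show "(\<lambda>\<pi>. inv \<rho> \<circ> \<pi>) ` {\<pi> \<in> ?P. ?act \<pi> = F} \<subseteq> automorphisms (V, E)"
        by (intro image_subsetI) simp
    qed
    then show ?thesis by (rule bij_betw_same_card[symmetric])
  qed
  have "fact (card V) = (\<Sum>\<pi>\<in>?P. 1)"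
    using card_permutations[OF refl fin] by simp
  also have "\<dots> = (\<Sum>F\<in>?O. \<Sum>\<pi>\<in>{\<pi> \<in> ?P. ?act \<pi> = F}. 1)"
    using act fin by (intro sum.group[symmetric]) (auto simp: finite_permutations)
  also have "\<dots> = (\<Sum>F\<in>?O. card (automorphisms (V, E)))"
    using fibre by (intro sum.cong refl) simp
  finally show ?thesis by simp
qed

text \<open>An isomorphism class of graphs with \<open>n\<close> vertices has \<open>n! / |Aut(G)|\<close> labellings.\<close>

lemma labelled_sum_eq_sum_classes:
  "labelled_sum f {..<n} = fact n * (\<Sum>G | num_verts G = n. f G / of_nat (aut_order G))"
proof -
  let ?V = "{..<n}" and ?cls = "\<lambda>E. abs_graph_class ({..<n}, E)"
  have card: "of_nat (card {E \<in> Pow (pairs ?V). ?cls E = G}) = (fact n / of_nat (aut_order G) :: complex)"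
    if n: "num_verts G = n" for G
  proof -
    obtain E where E: "simple_graph (?V, E)" "G = ?cls E"
      by (rule graph_class_on_cases[of ?V G]) (simp_all add: n)
    have "?cls F = G \<longleftrightarrow> graph_iso (?V, E) (?V, F)" if "F \<in> Pow (pairs ?V)" for F
      using abs_graph_class_eq_iff[of "(?V, E)" "(?V, F)"] E that by (auto simp: simple_graph_iff)
    then have eq: "{F \<in> Pow (pairs ?V). ?cls F = G} = {F \<in> Pow (pairs ?V). graph_iso (?V, E) (?V, F)}"
      by blast
    have aut: "aut_order G = card (automorphisms (?V, E))"
      using E aut_order.abs_eq[OF graph_iso_refl] by simp
    have prod: "card {F \<in> Pow (pairs ?V). ?cls F = G} * aut_order G = fact n"
      using card_labellings[OF E(1)] by (simp only: eq aut card_lessThan)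
    then have "aut_order G \<noteq> 0"
      using fact_nonzero[of n, where 'a = nat] by (intro notI) simp
    moreover have
      "of_nat (card {F \<in> Pow (pairs ?V). ?cls F = G}) * of_nat (aut_order G) = (fact n :: complex)"
      using prod by (metis of_nat_fact of_nat_mult)
    ultimately show ?thesis
      by (simp only: eq_divide_eq of_nat_eq_0_iff simp_thms if_True)
  qed
  have "labelled_sum f ?V =
      (\<Sum>G | num_verts G = n. \<Sum>E\<in>{E \<in> Pow (pairs ?V). ?cls E = G}. f (?cls E))"
    unfolding labelled_sum_def
    by (rule sum.group[symmetric])
      (auto simp: finite_num_verts num_verts_abs simple_graph_iff)
  also have "\<dots> = (\<Sum>G | num_verts G = n. fact n * (f G / of_nat (aut_order G)))"
  proof (intro sum.cong refl)
    fix G assume "G \<in> {G. num_verts G = n}"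
    then have n: "num_verts G = n" by simp
    have "(\<Sum>E\<in>{E \<in> Pow (pairs ?V). ?cls E = G}. f (?cls E)) =
        (\<Sum>E\<in>{E \<in> Pow (pairs ?V). ?cls E = G}. f G)"
      by (rule sum.cong) auto
    also have "\<dots> = fact n * (f G / of_nat (aut_order G))"
      by (simp only: sum_constant card[OF n] times_divide_eq_left times_divide_eq_right)
    finally show "(\<Sum>E\<in>{E \<in> Pow (pairs ?V). ?cls E = G}. f (?cls E)) =
        fact n * (f G / of_nat (aut_order G))" .
  qed
  finally show ?thesis by (simp add: sum_distrib_left)
qed

lemma sum_Pow_Un3:
  fixes h k :: "'a set \<Rightarrow> complex"
  assumes "finite A" "finite B" "finite C" "A \<inter> B = {}" "A \<inter> C = {}" "B \<inter> C = {}"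
  shows "(\<Sum>E\<in>Pow (A \<union> B \<union> C). h (E \<inter> A) * k (E \<inter> B)) =
    2 ^ card C * (\<Sum>E\<in>Pow A. h E) * (\<Sum>E\<in>Pow B. k E)"
proof -
  have "(\<Sum>E\<in>Pow (A \<union> B \<union> C). h (E \<inter> A) * k (E \<inter> B)) =
      (\<Sum>(E, F, G)\<in>Pow A \<times> Pow B \<times> Pow C. h E * k F)"
    by (rule sum.reindex_bij_witness[where i = "\<lambda>(E, F, G). E \<union> F \<union> G"
          and j = "\<lambda>E. (E \<inter> A, E \<inter> B, E \<inter> C)"]) (use assms in \<open>auto 4 3\<close>)
  also have "\<dots> = (\<Sum>E\<in>Pow A. \<Sum>F\<in>Pow B. \<Sum>G\<in>Pow C. h E * k F)"
    by (simp only: sum.cartesian_product)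
  also have "\<dots> = (\<Sum>E\<in>Pow A. \<Sum>F\<in>Pow B. 2 ^ card C * (h E * k F))"
    using assms by (simp add: card_Pow)
  also have "\<dots> = 2 ^ card C * ((\<Sum>E\<in>Pow A. h E) * (\<Sum>E\<in>Pow B. k E))"
    by (simp only: sum_distrib_left[of "2 ^ card C", symmetric] sum_product)
  finally show ?thesis by (simp only: mult.assoc)
qed

text \<open>The edges between the two parts of a partition of the vertices.\<close>

lemma card_crossing_pairs:
  assumes "finite V" "W \<subseteq> V"
  shows "card (pairs V - pairs W - pairs (V - W)) = card W * card (V - W)"
proof -
  have "pairs V - pairs W - pairs (V - W) = (\<lambda>(u, v). {u, v}) ` (W \<times> (V - W))"
    using assms(2) unfolding pairs_def card_2_iff by (auto simp: image_iff)
  moreover have "inj_on (\<lambda>(u, v). {u, v}) (W \<times> (V - W))"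
    by (auto simp: inj_on_def doubleton_eq_iff)
  ultimately show ?thesis
    by (simp add: card_image card_cartesian_product)
qed

text \<open>A pair of labelled graphs on \<open>W\<close> and on its complement arises by restriction from
  \<open>2 ^ (card W * card (V - W))\<close> graphs on \<open>V\<close>, since the edges between the parts are arbitrary.\<close>

lemma sum_induced_labelled:
  assumes "finite V" "W \<subseteq> V"
  shows "(\<Sum>E\<in>Pow (pairs V). f (abs_graph_class (induced (V, E) W)) *
            g (abs_graph_class (induced (V, E) (V - W)))) =
    2 ^ (card W * card (V - W)) * labelled_sum f W * labelled_sum g (V - W)"
proof -
  let ?C = "pairs V - pairs W - pairs (V - W)"
  have fin: "finite W" using assms by (rule finite_subset[rotated])
  have disj: "pairs W \<inter> pairs (V - W) = {}"
    unfolding pairs_def card_2_iff by auto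
  have part: "pairs V = pairs W \<union> pairs (V - W) \<union> ?C"
    using assms(2) by (auto simp: pairs_def)
  have ind: "induced (V, E) U = (U, E \<inter> pairs U)" if "E \<in> Pow (pairs V)" for E U
    using that by (auto simp: induced_def pairs_def)
  have "(\<Sum>E\<in>Pow (pairs V). f (abs_graph_class (induced (V, E) W)) *
            g (abs_graph_class (induced (V, E) (V - W)))) =
      (\<Sum>E\<in>Pow (pairs W \<union> pairs (V - W) \<union> ?C). f (abs_graph_class (W, E \<inter> pairs W)) *
            g (abs_graph_class (V - W, E \<inter> pairs (V - W))))"
    by (rule sum.cong) (use part ind in auto)
  also have "\<dots> = 2 ^ card ?C * labelled_sum f W * labelled_sum g (V - W)"
    unfolding labelled_sum_def using assms(1) fin disj by (intro sum_Pow_Un3) auto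
  finally show ?thesis
    by (simp only: card_crossing_pairs[OF assms])
qed


section \<open>Disconnected graphs\<close>

text \<open>A nonempty disconnected graph is the disjoint union of the component of a vertex and of the
  rest.\<close>

lemma disconnected_imp_sum:
  assumes "\<not> is_connected G" "G \<noteq> 0"
  obtains G1 G2 where "G = G1 + G2" "num_verts G1 \<noteq> 0" "num_verts G2 \<noteq> 0"
proof -
  obtain A where A: "simple_graph A" "G = abs_graph_class A" by (rule graph_class_cases)
  define R where "R = {(x, y). {x, y} \<in> edges A}"
  have "verts A \<noteq> {}"
  proof
    assume "verts A = {}"
    then have "A = ({}, {})" using A(1) by (cases A) (auto simp: simple_graph_def)
    then show False using assms(2) A(2) by (simp add: zero_graph_class_def)
  qed
  moreover have "\<not> connected_graph A"
    using assms(1) A is_connected.abs_eq[OF graph_iso_refl] by simp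
  ultimately obtain u v where uv: "u \<in> verts A" "v \<in> verts A" "(u, v) \<notin> R\<^sup>*"
    by (auto simp: connected_graph_def R_def)
  define C where "C = {x \<in> verts A. (u, x) \<in> R\<^sup>*}"
  let ?A1 = "induced A C" and ?A2 = "induced A (verts A - C)"
  have C: "C \<subseteq> verts A" "u \<in> C" "v \<notin> C" using uv by (auto simp: C_def)
  have side: "e \<subseteq> C \<or> e \<subseteq> verts A - C" if e: "e \<in> edges A" for e
  proof -
    obtain x y where xy: "e = {x, y}" "x \<in> verts A" "y \<in> verts A"
      using A(1) e by (auto simp: simple_graph_def card_2_iff)
    then have "(x, y) \<in> R" "(y, x) \<in> R" using e by (auto simp: R_def insert_commute)
    then have "x \<in> C \<longleftrightarrow> y \<in> C"
      using xy by (auto simp: C_def intro: rtrancl_into_rtrancl)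
    then show ?thesis using xy by auto
  qed
  \<comment> \<open>The numbering of the vertices of a disjoint union by even and odd numbers.\<close>
  define h where "h x = (if x \<in> C then 2 * x else 2 * x + 1)" for x :: nat
  have inj: "inj_on h (verts A)"
    by (auto simp: inj_on_def h_def; presburger)
  have img: "h ` verts A = (\<lambda>v. 2 * v) ` C \<union> (\<lambda>v. 2 * v + 1) ` (verts A - C)"
    using C(1) by (auto simp: h_def image_iff)
  have h1: "h ` e = (\<lambda>v. 2 * v) ` e" if "e \<subseteq> C" for e
    using that by (intro image_cong) (auto simp: h_def)
  have h2: "h ` e = (\<lambda>v. 2 * v + 1) ` e" if "e \<subseteq> verts A - C" for e
    using that by (intro image_cong) (auto simp: h_def)
  have split: "edges A = {e \<in> edges A. e \<subseteq> C} \<union> {e \<in> edges A. e \<subseteq> verts A - C}"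
    using side by blast
  have "(`) h ` {e \<in> edges A. e \<subseteq> C} = (`) (\<lambda>v. 2 * v) ` {e \<in> edges A. e \<subseteq> C}"
    by (rule image_cong[OF refl], rule h1) simp
  moreover have "(`) h ` {e \<in> edges A. e \<subseteq> verts A - C} =
      (`) (\<lambda>v. 2 * v + 1) ` {e \<in> edges A. e \<subseteq> verts A - C}"
    by (rule image_cong[OF refl], rule h2) simp
  ultimately have "(`) h ` edges A = (`) (\<lambda>v. 2 * v) ` {e \<in> edges A. e \<subseteq> C} \<union>
      (`) (\<lambda>v. 2 * v + 1) ` {e \<in> edges A. e \<subseteq> verts A - C}"
    by (subst split) (simp only: image_Un)
  then have "graph_map h A (disjoint_union ?A1 ?A2)"
    using inj img by (simp add: graph_map_def bij_betw_def disjoint_union_def induced_def)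
  moreover have s: "simple_graph ?A1" "simple_graph ?A2"
    using A(1) C(1) by (auto intro: simple_graph_induced)
  ultimately have "graph_iso A (disjoint_union ?A1 ?A2)"
    using A(1) by (auto simp: graph_iso_def simple_graph_disjoint_union)
  then have "G = abs_graph_class ?A1 + abs_graph_class ?A2"
    using A(2) plus_graph_class.abs_eq[OF graph_iso_refl[OF s(1)] graph_iso_refl[OF s(2)]]
      Quotient3_rel_abs[OF Quotient3_graph_class] by metis
  moreover have "finite (verts A)" "finite C"
    using A(1) C(1) by (auto simp: simple_graph_def intro: finite_subset)
  then have "num_verts (abs_graph_class ?A1) \<noteq> 0" "num_verts (abs_graph_class ?A2) \<noteq> 0"
    unfolding num_verts_abs[OF s(1)] num_verts_abs[OF s(2)] using C uv(2) by (auto simp: induced_def)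
  ultimately show thesis by (rule that)
qed

lemma coeff_mult_var_eq_0:
  fixes p q :: polynomial
  assumes "coeff p 0 = 0" "coeff q 0 = 0"
  shows "coeff (p * q) (var k) = 0"
proof -
  have eq: "coeff p l * Sum_any (\<lambda>m. coeff q m when var k = l + m) = 0" for l
  proof (cases "l = 0")
    case False
    have "m = 0" if "var k = l + m" for m
    proof -
      have "mono_deg l + mono_deg m = Suc 0"
        using that mono_deg_add[of l m] by (metis mono_deg_var)
      then show ?thesis using False by (metis add_is_1 mono_deg_eq_0_iff)
    qed
    then have "(coeff q m when var k = l + m) = 0" for m
      using assms(2) by (auto simp: when_def)
    then show ?thesis by simp
  qed (simp add: assms(1))
  show ?thesis unfolding lookup_mult eq by simp
qed


section \<open>Umbral invariants\<close>

text \<open>The sum of all labelled graphs on \<open>V\<close> in the graph algebra.\<close>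

definition graph_sum :: "nat set \<Rightarrow> graph_algebra" where
  "graph_sum V = (\<Sum>E\<in>Pow (pairs V). basis (abs_graph_class (V, E)))"

text \<open>The coefficient of \<open>m\<close> in the sum of the invariants of all labelled graphs on \<open>V\<close>.\<close>

definition labelled_coeff :: "(graph_algebra \<Rightarrow> polynomial) \<Rightarrow> nat set \<Rightarrow> mono \<Rightarrow> complex" where
  "labelled_coeff I V m = labelled_sum (\<lambda>G. coeff (I (basis G)) m) V"

text \<open>The coefficient of \<open>m\<close> in the image of the group-like element, multiplied by the factorials of
  the exponents. Only the labelled graphs with \<^term>\<open>weight m\<close> vertices matter, because the
  invariant is graded.\<close>

definition normalised_coeff :: "(graph_algebra \<Rightarrow> polynomial) \<Rightarrow> mono \<Rightarrow> complex" where
  "normalised_coeff I m = mono_fact m * labelled_coeff I {..<weight m} m /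
     (fact (weight m) * 2 ^ (weight m * (weight m - 1) div 2))"

context
  fixes I :: "graph_algebra \<Rightarrow> polynomial"
  assumes I: "umbral_invariant I"
begin

lemma coeff_I_graph_sum: "coeff (I (graph_sum V)) m = labelled_coeff I V m"
proof -
  interpret Vector_Spaces.linear scale scale I
    using I by (simp add: umbral_invariant_def)
  show ?thesis
    by (simp add: graph_sum_def sum lookup_sum labelled_coeff_def labelled_sum_def)
qed

lemma coeff_I_basis_eq_0:
  assumes "num_verts G \<noteq> weight m"
  shows "coeff (I (basis G)) m = 0"
proof -
  have "basis G \<in> homogeneous num_verts (num_verts G)"
    by (simp add: homogeneous_def)
  then have "I (basis G) \<in> homogeneous weight (num_verts G)"
    using I unfolding umbral_invariant_def by blast
  then have "m \<notin> Poly_Mapping.keys (I (basis G))"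
    using assms by (auto simp: homogeneous_def)
  then show ?thesis by (simp add: in_keys_iff)
qed

lemma labelled_coeff_eq_0: "finite V \<Longrightarrow> card V \<noteq> weight m \<Longrightarrow> labelled_coeff I V m = 0"
  unfolding labelled_coeff_def labelled_sum_def
  by (intro sum.neutral ballI coeff_I_basis_eq_0) (auto simp: num_verts_abs simple_graph_iff)

lemma labelled_coeff_cong_card:
  "finite V \<Longrightarrow> finite W \<Longrightarrow> card V = card W \<Longrightarrow> labelled_coeff I V m = labelled_coeff I W m"
  unfolding labelled_coeff_def by (rule labelled_sum_cong_card)

lemma coeff_tensor_coproduct_graph_sum:
  assumes "finite V"
  shows "coeff (tensor_map I (graph_coproduct (graph_sum V))) (a, b) =
    (\<Sum>W\<in>Pow V. 2 ^ (card W * card (V - W)) * labelled_coeff I W a * labelled_coeff I (V - W) b)"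
proof -
  have cop: "graph_coproduct_basis (abs_graph_class (V, E)) = (\<Sum>W\<in>Pow V.
      basis (abs_graph_class (induced (V, E) W), abs_graph_class (induced (V, E) (V - W))))"
    if "E \<in> Pow (pairs V)" for E
    using graph_coproduct_basis.abs_eq[OF graph_iso_refl, of "(V, E)"] that assms
    by (simp add: simple_graph_iff)
  have "coeff (tensor_map I (graph_coproduct (graph_sum V))) (a, b) =
      (\<Sum>E\<in>Pow (pairs V). \<Sum>W\<in>Pow V.
         coeff (I (basis (abs_graph_class (induced (V, E) W)))) a *
         coeff (I (basis (abs_graph_class (induced (V, E) (V - W))))) b)"
    by (simp add: graph_coproduct_def graph_sum_def tensor_map_def lin_ext_sum cop lookup_sum
        coeff_tensor)
  also have "\<dots> = (\<Sum>W\<in>Pow V. \<Sum>E\<in>Pow (pairs V).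
         coeff (I (basis (abs_graph_class (induced (V, E) W)))) a *
         coeff (I (basis (abs_graph_class (induced (V, E) (V - W))))) b)"
    by (rule sum.swap)
  also have "\<dots> = (\<Sum>W\<in>Pow V. 2 ^ (card W * card (V - W)) * labelled_coeff I W a * labelled_coeff I (V - W) b)"
    unfolding labelled_coeff_def
    by (intro sum.cong refl sum_induced_labelled[OF assms, where
          f = "\<lambda>G. coeff (I (basis G)) a" and g = "\<lambda>G. coeff (I (basis G)) b"]) auto
  finally show ?thesis .
qed

text \<open>Compatibility with the coproducts, applied to the sum of all labelled graphs. By grading, only
  the subsets \<open>W\<close> with \<^term>\<open>weight a\<close> elements contribute to the coefficient of \<open>a \<otimes> b\<close>.\<close>

lemma labelled_coeff_add:
  fixes a b :: mono
  defines "n \<equiv> weight a" and "k \<equiv> weight b"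
  shows "mono_fact (a + b) * labelled_coeff I {..<n + k} (a + b) =
    of_nat (n + k choose n) * 2 ^ (n * k) *
      (mono_fact a * labelled_coeff I {..<n} a) * (mono_fact b * labelled_coeff I {..<k} b)"
proof -
  let ?V = "{..<n + k}"
  have W: "2 ^ (card W * card (?V - W)) * labelled_coeff I W a * labelled_coeff I (?V - W) b =
      (if card W = n then 2 ^ (n * k) * labelled_coeff I {..<n} a * labelled_coeff I {..<k} b else 0)"
    if "W \<in> Pow ?V" for W
  proof (cases "card W = n")
    case True
    have fin: "finite W" using that finite_subset by auto
    have "card (?V - W) = k" using that True fin by (simp add: card_Diff_subset)
    then show ?thesis
      using True fin labelled_coeff_cong_card[of W "{..<n}" a]
        labelled_coeff_cong_card[of "?V - W" "{..<k}" b] by simp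
  next
    case False
    have "finite W" using that finite_subset by auto
    then show ?thesis using False labelled_coeff_eq_0[of W a] by (simp add: n_def)
  qed
  have "mono_fact (a + b) * labelled_coeff I ?V (a + b) =
      mono_fact a * mono_fact b * coeff (poly_coproduct (I (graph_sum ?V))) (a, b)"
    by (simp add: coeff_poly_coproduct coeff_I_graph_sum)
  also have "poly_coproduct (I (graph_sum ?V)) = tensor_map I (graph_coproduct (graph_sum ?V))"
    using I by (simp add: umbral_invariant_def)
  also have "coeff \<dots> (a, b) = (\<Sum>W\<in>Pow ?V.
      if card W = n then 2 ^ (n * k) * labelled_coeff I {..<n} a * labelled_coeff I {..<k} b else 0)"
    unfolding coeff_tensor_coproduct_graph_sum[OF finite_lessThan] by (intro sum.cong refl W)
  also have "\<dots> = (\<Sum>W\<in>{W. W \<subseteq> ?V \<and> card W = n}. 2 ^ (n * k) * labelled_coeff I {..<n} a * labelled_coeff I {..<k} b)"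
    by (rule sum.mono_neutral_cong_right) auto
  also have "\<dots> = of_nat (n + k choose n) * (2 ^ (n * k) * labelled_coeff I {..<n} a * labelled_coeff I {..<k} b)"
    by (simp add: n_subsets)
  finally show ?thesis by (simp add: mult_ac)
qed

text \<open>The power of 2 in the normalisation absorbs the edges between the two parts, because
  \<open>(n + k choose 2) = (n choose 2) + (k choose 2) + n k\<close>. This is the statement that the normalised
  sum of all graphs is group-like.\<close>

lemma normalised_coeff_add: "normalised_coeff I (a + b) = normalised_coeff I a * normalised_coeff I b"
proof -
  define n k where "n = weight a" and "k = weight b"
  have tri: "(n + k) * (n + k - 1) div 2 = n * (n - 1) div 2 + k * (k - 1) div 2 + n * k"
  proof -
    have e: "2 * (j * (j - 1) div 2) = j * (j - 1)" for j :: nat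
      by (rule dvd_mult_div_cancel) (cases j, simp_all)
    have "(n + k) * (n + k - 1) = n * (n - 1) + k * (k - 1) + 2 * (n * k)"
      by (cases n; cases k) (simp_all add: algebra_simps)
    then show ?thesis using e[of "n + k"] e[of n] e[of k] by linarith
  qed
  have bin: "of_nat (n + k choose n) = (fact (n + k) / (fact n * fact k) :: complex)"
    using binomial_fact[of n "n + k"] by simp
  have "normalised_coeff I (a + b) = mono_fact (a + b) * labelled_coeff I {..<n + k} (a + b) /
      (fact (n + k) * 2 ^ ((n + k) * (n + k - 1) div 2))"
    by (simp add: normalised_coeff_def weight_add n_def k_def)
  also have "\<dots> = normalised_coeff I a * normalised_coeff I b"
    unfolding n_def k_def labelled_coeff_add unfolding n_def[symmetric] k_def[symmetric] bin tri power_add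
    by (simp add: normalised_coeff_def field_simps flip: n_def k_def)
  finally show ?thesis .
qed

lemma I_basis_0: "I (basis 0) = 1"
  using I by (simp add: umbral_invariant_def single_one)

lemma labelled_coeff_empty: "labelled_coeff I {} 0 = 1"
proof -
  have "pairs ({} :: nat set) = {}" by (auto simp: pairs_def)
  then show ?thesis
    using I_basis_0 by (simp add: labelled_coeff_def labelled_sum_def zero_graph_class_def[symmetric] lookup_one)
qed

text \<open>Hence the image of the group-like element is the exponential of its linear part.\<close>

lemma normalised_coeff_eq: "normalised_coeff I m = mono_eval (\<lambda>k. normalised_coeff I (var k)) m"
proof (induction m rule: mono_induct)
  case zero
  then show ?case by (simp add: normalised_coeff_def labelled_coeff_empty)
next
  case (add m k)
  then show ?case by (simp add: normalised_coeff_add mono_eval_add)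
qed

lemma sum_classes_eq_labelled_coeff:
  "(\<Sum>G | num_verts G = weight m. coeff (I (basis G)) m / of_nat (aut_order G)) =
     labelled_coeff I {..<weight m} m / fact (weight m)"
  by (simp add: labelled_coeff_def labelled_sum_eq_sum_classes)

lemma generating_function_eq:
  "generating_function I m = labelled_coeff I {..<weight m} m / fact (weight m)"
  unfolding generating_function_def sum_classes_eq_labelled_coeff[symmetric]
  by (rule Sum_any.expand_superset) (auto simp: finite_num_verts intro: ccontr coeff_I_basis_eq_0)

text \<open>The invariant of a disjoint union of nonempty graphs is a product of two polynomials without
  constant term, hence has no linear part. The empty graph, which is not connected either, has the
  invariant 1.\<close>

lemma coeff_I_disconnected:
  assumes "\<not> is_connected G"
  shows "coeff (I (basis G)) (var k) = 0"
proof (cases "G = 0")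
  case True
  have "var k \<noteq> 0" using weight_var[of k] weight_0 by (metis nat.distinct(1))
  then show ?thesis unfolding True I_basis_0 by (simp add: lookup_one)
next
  case False
  then obtain G1 G2 where G: "G = G1 + G2" "num_verts G1 \<noteq> 0" "num_verts G2 \<noteq> 0"
    using disconnected_imp_sum assms by blast
  have "basis G = basis G1 * basis G2"
    by (simp add: G(1) mult_single)
  then have "I (basis G) = I (basis G1) * I (basis G2)"
    using I by (simp add: umbral_invariant_def)
  then show ?thesis
    using G by (simp add: coeff_mult_var_eq_0 coeff_I_basis_eq_0)
qed

text \<open>Therefore the restriction to connected graphs in the constants may be dropped.\<close>

lemma i_const_eq: "i_const I (Suc k) = labelled_coeff I {..<Suc k} (var k)"
proof -
  have "Sum_any (\<lambda>G. if is_connected G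
      then coeff (I (basis G)) (var_mono (Suc k)) / of_nat (aut_order G) else 0) =
      generating_function I (var k)"
    unfolding generating_function_def
    by (rule Sum_any.cong) (simp add: coeff_I_disconnected var_mono_def)
  then show ?thesis
    unfolding i_const_def generating_function_eq weight_var by (simp del: fact_Suc)
qed

end

theorem theorem2p4:
  fixes I :: "graph_algebra \<Rightarrow> polynomial"
  assumes "umbral_invariant I"
    and "\<And>n. n \<ge> 1 \<Longrightarrow> i_const I n \<noteq> 0"
  shows "rescale (\<lambda>n. 2 ^ (n * (n - 1) div 2) * fact (n - 1) / i_const I n) (generating_function I)
           = schur_series"
proof
  fix m
  let ?c = "\<lambda>n. 2 ^ (n * (n - 1) div 2) * fact (n - 1) / i_const I n"
  let ?w = "\<lambda>k. 1 / of_nat (Suc k) :: complex" and ?F = "normalised_coeff I"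
  have F: "?F (var k) * ?c (Suc k) = ?w k" for k
  proof -
    have "?F (var k) = i_const I (Suc k) / (fact (Suc k) * 2 ^ (Suc k * k div 2))"
      using i_const_eq[OF assms(1), of k] mono_fact_add_var[of 0 k]
      by (simp add: normalised_coeff_def)
    then show ?thesis
      using assms(2)[of "Suc k"] by (simp add: divide_simps mult_ac del: of_nat_Suc)
  qed
  have "generating_function I m =
      2 ^ (weight m * (weight m - 1) div 2) * mono_eval (\<lambda>k. ?F (var k)) m / mono_fact m"
    using normalised_coeff_eq[OF assms(1), of m]
    by (simp add: generating_function_eq[OF assms(1)] normalised_coeff_def divide_simps mult_ac)
  moreover have "mono_eval (\<lambda>k. ?F (var k)) m * mono_eval (\<lambda>k. ?c (Suc k)) m = mono_eval ?w m"
    unfolding mono_eval_def by (simp only: F flip: prod.distrib power_mult_distrib)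
  ultimately show "rescale ?c (generating_function I) m = schur_series m"
    unfolding rescale_def mono_eval_def[of "\<lambda>k. ?c (Suc k)", symmetric] schur_series_eq
    by (simp add: mult.assoc)
qed

end
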